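(* Let $a(x,D)$ be a periodic pseudodifferential operator with symbol $(a(\cdot,k))_{k\in\mathbb{Z}^N}$, where for each $k\in\mathbb{Z}^N$ the function $a(\cdot,k):B=[-\pi,\pi)^N\to\mathbb{C}$ is smooth and periodic, and let $k_a$ be its Schwartz kernel. For even $m\in\mathbb{N}$, it is natural to approximate $k_a$ by the truncated series expansion $$k_a^m(x,y)=\frac{1}{(2\pi)^{N}}\sum_{k\in\mathbb{Z}^N_m}a(x,k)\,e^{ik\cdot(x-y)},$$ where $$\mathbb{Z}^N_m=\{k\in\mathbb{Z}^N : k_i=-m/2,\dots,m/2-1\text{ for } i=1,\dots,N\}.$$ In this case one has, for $x,y\in B$, that $$k_a^m(x,y)=\bigl(a^m(x,D)\,\delta_y^m\,\big|\,\delta_x^m\bigr)_{q^m},$$ for $a^m(x,D)=\mathcal{F}_m^{-1}\,a^m(x,\cdot)\,\mathcal{F}_m$ and $a^m(x,k)=a(x,k)$, $k\in\mathbb{Z}^N_m$.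
   Context: Notation. $e_k(x)=(2\pi)^{-N/2}e^{ik\cdot x}$ for $k\in\mathbb{Z}^N$, $x\in\mathbb{R}^N$. The operator is $a(x,D)\varphi=\sum_{k\in\mathbb{Z}^N}e_k(x)a(x,k)\hat\varphi_k$ for smooth $2\pi$-periodic $\varphi$, with $\hat\varphi_k=\int_B\varphi\,\overline{e_k}\,dx$; its Schwartz kernel is $k_a(x,y)=\frac{1}{(2\pi)^N}\sum_{k\in\mathbb{Z}^N}e^{ik\cdot(x-y)}a(x,k)=\sum_{k\in\mathbb{Z}^N}e_k(x)e_k(-y)a(x,k)$. Grid. $G^m=(G_1^m)^N$ with $G_1^m=\{-\pi+\frac{2\pi}{m}j : j=0,\dots,m-1\}$. Grid functions are functions $v:G^m\to\mathbb{C}$, and $e_k^m$ denotes the restriction of $e_k$ to $G^m$. The discrete scalar product (trapezoidal rule) is $$(v|w)_{q^m}=\Bigl(\frac{2\pi}{m}\Bigr)^N\sum_{z\in G^m}v(z)\,\overline{w(z)},$$ with respect to which $(e_k^m)_{k\in\mathbb{Z}^N_m}$ is orthonormal. Discrete Fourier transform: $\mathcal{F}_m(v)=\bigl((v|e_k^m)_{q^m}\bigr)_{k\in\mathbb{Z}^N_m}$. In $a^m(x,D)$, the symbol $a^m(x,\cdot)$ acts, for fixed $x$, by multiplication on sequences indexed by $\mathbb{Z}^N_m$. Discrete Dirac distribution: for a point $x_0\in[-\pi,\pi)$ in one dimension (not necessarily a grid point), $\delta_{x_0}^m=\sum_{k=-m/2}^{m/2-1}e_k(x_0)\,\overline{e_k^m}$;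 in dimension $N$, for $x_0=(x_0^1,\dots,x_0^N)\in B$, $\delta^m_{x_0}=\delta^m_{x_0^1}\otimes\cdots\otimes\delta^m_{x_0^N}$ is the tensor product of the one-dimensional grid functions.
   Formalization: The printed identity fails for general x,y in B (N=1, m=2, a=1, x=0, y=π/2); proved instead: for all x,y in B with δ_x^m, δ_y^m replaced by their complex conjugates, and as printed when every x_i−y_i is an integer multiple of 2π/m (e.g. grid points). *)

theory Defs
  imports "HOL-Analysis.Analysis" "HOL-Library.FuncSet"
begin

text \<open>
  The dimension \<open>N\<close> is \<open>CARD('n)\<close>, so \<open>real ^ 'n\<close> is \<open>N\<close>-dimensional space and \<open>int ^ 'n\<close> is the
  lattice of frequencies. Functions on a finite index set (grid functions on \<open>grid m\<close>, sequences on
  \<open>freqs m\<close>) are extensional functions, so that the discrete Fourier transform has an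
  honest inverse map.
\<close>

definition base_cube :: "(real ^ 'n) set" where
  "base_cube = {x. \<forall>i. - pi \<le> x $ i \<and> x $ i < pi}"

text \<open>\<open>C_class r f\<close>: all partial derivatives of \<open>f\<close> up to order \<open>r\<close> exist and are continuous.\<close>

primrec C_class :: "nat \<Rightarrow> (real ^ 'n \<Rightarrow> complex) \<Rightarrow> bool" where
  "C_class 0 f \<longleftrightarrow> continuous_on UNIV f"
| "C_class (Suc r) f \<longleftrightarrow> continuous_on UNIV f \<and>
     (\<forall>i. \<exists>g. C_class r g \<and>
        (\<forall>x. ((\<lambda>t. f (x + t *\<^sub>R axis i 1)) has_vector_derivative g x) (at 0)))"

definition smooth :: "(real ^ 'n \<Rightarrow> complex) \<Rightarrow> bool" where
  "smooth f \<longleftrightarrow> (\<forall>r. C_class r f)"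

definition periodic :: "(real ^ 'n \<Rightarrow> complex) \<Rightarrow> bool" where
  "periodic f \<longleftrightarrow> (\<forall>i x. f (x + axis i (2 * pi)) = f x)"

text \<open>A smooth periodic function on the box is identified with its periodic extension.\<close>

definition periodic_symbol :: "(real ^ 'n \<Rightarrow> int ^ 'n \<Rightarrow> complex) \<Rightarrow> bool" where
  "periodic_symbol a \<longleftrightarrow> (\<forall>k. smooth (\<lambda>x. a x k) \<and> periodic (\<lambda>x. a x k))"

definition phase :: "int ^ 'n \<Rightarrow> real ^ 'n \<Rightarrow> real" where
  "phase k x = (\<Sum>i\<in>UNIV. of_int (k $ i) * x $ i)"

definition fourier :: "int ^ 'n \<Rightarrow> real ^ 'n \<Rightarrow> complex" where
  "fourier k x = of_real ((2 * pi) powr (- real CARD('n) / 2)) * exp (\<i> * of_real (phase k x))"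

definition fourier1 :: "int \<Rightarrow> real \<Rightarrow> complex" where
  "fourier1 k x = of_real ((2 * pi) powr (- 1 / 2)) * exp (\<i> * of_real (of_int k * x))"

definition freqs1 :: "nat \<Rightarrow> int set" where
  "freqs1 m = {- (int m div 2) .. int m div 2 - 1}"

definition freqs :: "nat \<Rightarrow> (int ^ 'n) set" where
  "freqs m = {k. \<forall>i. k $ i \<in> freqs1 m}"

definition grid1 :: "nat \<Rightarrow> real set" where
  "grid1 m = (\<lambda>j. - pi + 2 * pi / real m * real j) ` {..<m}"

definition grid :: "nat \<Rightarrow> (real ^ 'n) set" where
  "grid m = {z. \<forall>i. z $ i \<in> grid1 m}"

definition kernel_term ::
    "(real ^ 'n \<Rightarrow> int ^ 'n \<Rightarrow> complex) \<Rightarrow> real ^ 'n \<Rightarrow> real ^ 'n \<Rightarrow> int ^ 'n \<Rightarrow> complex" where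
  "kernel_term a x y k =
     of_real (1 / (2 * pi) ^ CARD('n)) * (a x k * exp (\<i> * of_real (phase k (x - y))))"

text \<open>
  The Schwartz kernel is the (in general only distributionally convergent) series of
  \<open>kernel_term a x y k\<close> over all \<open>k\<close>; this is its truncation.
\<close>

definition truncated_kernel ::
    "nat \<Rightarrow> (real ^ 'n \<Rightarrow> int ^ 'n \<Rightarrow> complex) \<Rightarrow> real ^ 'n \<Rightarrow> real ^ 'n \<Rightarrow> complex" where
  "truncated_kernel m a x y = (\<Sum>k\<in>freqs m. kernel_term a x y k)"

definition qinner ::
    "nat \<Rightarrow> (real ^ 'n \<Rightarrow> complex) \<Rightarrow> (real ^ 'n \<Rightarrow> complex) \<Rightarrow> complex" where
  "qinner m v w = of_real ((2 * pi / real m) ^ CARD('n)) * (\<Sum>z\<in>grid m. v z * cnj (w z))"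

definition fourier_grid :: "nat \<Rightarrow> int ^ 'n \<Rightarrow> real ^ 'n \<Rightarrow> complex" where
  "fourier_grid m k = restrict (fourier k) (grid m)"

definition dft :: "nat \<Rightarrow> (real ^ 'n \<Rightarrow> complex) \<Rightarrow> int ^ 'n \<Rightarrow> complex" where
  "dft m v = (\<lambda>k\<in>freqs m. qinner m v (fourier_grid m k))"

definition inv_dft :: "nat \<Rightarrow> (int ^ 'n \<Rightarrow> complex) \<Rightarrow> real ^ 'n \<Rightarrow> complex" where
  "inv_dft m = inv_into (extensional (grid m)) (dft m)"

text \<open>
  \<open>discrete_op m a x v\<close> is $a^m(x,D) v$: the point \<open>x\<close> is a parameter, and
  $a^m(x,\cdot)$ multiplies sequences indexed by \<open>freqs m\<close>.
\<close>

definition discrete_op ::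
    "nat \<Rightarrow> (real ^ 'n \<Rightarrow> int ^ 'n \<Rightarrow> complex) \<Rightarrow> real ^ 'n \<Rightarrow>
     (real ^ 'n \<Rightarrow> complex) \<Rightarrow> real ^ 'n \<Rightarrow> complex" where
  "discrete_op m a x v = inv_dft m (\<lambda>k\<in>freqs m. a x k * dft m v k)"

definition delta1 :: "nat \<Rightarrow> real \<Rightarrow> real \<Rightarrow> complex" where
  "delta1 m x0 = (\<lambda>z\<in>grid1 m. \<Sum>k\<in>freqs1 m. fourier1 k x0 * cnj (fourier1 k z))"

definition delta :: "nat \<Rightarrow> real ^ 'n \<Rightarrow> real ^ 'n \<Rightarrow> complex" where
  "delta m x0 = (\<lambda>z\<in>grid m. \<Prod>i\<in>UNIV. delta1 m (x0 $ i) (z $ i))"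

text \<open>
  Pointwise complex conjugation of a grid function. Off the grid it matters for \<open>delta\<close>: \<open>freqs1 m\<close>
  contains $-m/2$ but not $m/2$, so the coefficient of \<open>delta1 m y\<close> at the frequency
  $-m/2$ is \<open>fourier1 (-m/2) y\<close> and not its conjugate. Consequently
  \<open>qinner m (discrete_op m a x (delta m y)) (delta m x)\<close> agrees with the truncated kernel
  only up to a conjugation at that frequency (for \<open>N = 1\<close>, \<open>m = 2\<close>, \<open>a = 1\<close>, \<open>x = 0\<close>,
  \<open>y = pi/2\<close> the two sides are $(1 - i)/(2\pi)$ and $(1 + i)/(2\pi)$), whereas with
  the conjugated distributions there is equality for all \<open>x\<close> and \<open>y\<close>. Without
  the conjugation, equality holds for every symbol precisely when all coordinates of \<open>x - y\<close> are integer
  multiples of the mesh size, in particular when \<open>x\<close> and \<open>y\<close> are grid points.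
  For a grid point \<open>x0\<close>, \<open>delta m x0\<close> is real and the conjugation has no effect.
\<close>

definition grid_cnj :: "nat \<Rightarrow> (real ^ 'n \<Rightarrow> complex) \<Rightarrow> real ^ 'n \<Rightarrow> complex" where
  "grid_cnj m v = (\<lambda>z\<in>grid m. cnj (v z))"

end

theory Submission
  imports Defs
begin

text \<open>
  The restricted exponentials with frequencies in \<open>freqs m\<close> form an orthonormal basis of the grid
  functions, so every discrete object here is determined by its coefficients. Write
  \<open>synthesis m c\<close> for the grid function with coefficients \<open>c\<close>. Then \<open>inv_dft m\<close> is
  synthesis (\<open>inv_dft_restrict\<close>), the discrete operator multiplies coefficients by the symbol
  (\<open>discrete_op_synthesis\<close>), and the discrete scalar product becomes the scalar product of
  coefficients (\<open>qinner_synthesis\<close>). The conjugate of \<open>delta m y\<close> has the coefficients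
  \<open>cnj (fourier k y)\<close> (\<open>grid_cnj_delta\<close>), so the first claimed scalar product is the sum of
  \<open>a x k * cnj (fourier k y) * fourier k x\<close> over \<open>k\<close>, and this is the truncated kernel.

  Both orthogonality relations, over grid points and over frequencies, reduce to dimension one by
  factorising the sums over boxes, and there to geometric sums over roots of unity. The second one
  says that the basis is complete, which makes the transform injective.

  The distribution \<open>delta m y\<close> itself is a combination of the exponentials with frequencies
  \<open>-k\<close>. In a coordinate where \<open>k\<close> is \<open>-m/2\<close> the frequency \<open>m/2\<close> is outside the
  window, but on the grid it is aliased to \<open>-m/2\<close>. Hence the coefficients of \<open>delta m y\<close> are
  \<open>fourier k' y\<close>, where \<open>k'\<close> is the negative of \<open>k\<close> modulo \<open>m\<close>
  (\<open>delta_eq_synthesis\<close>). The product of the coefficients for \<open>y\<close> and \<open>x\<close> depends only on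
  \<open>x - y\<close>. If this difference lies in the mesh lattice, the same aliasing turns \<open>k'\<close> back into
  \<open>-k\<close> and the truncated kernel appears again (\<open>fourier_neg_freq_mult_cnj\<close>).
\<close>

section \<open>Sums over boxes of vectors\<close>

text \<open>
  The grid, the frequency window and the exponentials are all products over the coordinates. Expanding
  a product of sums is what reduces orthogonality, and the expansion of \<open>delta\<close>, to dimension one.
\<close>

lemma sum_vec_box_prod:
  fixes f :: "'n::finite \<Rightarrow> 'b \<Rightarrow> 'c::comm_semiring_1"
  assumes "finite A"
  shows "(\<Sum>v\<in>{v :: 'b ^ 'n. \<forall>i. v $ i \<in> A}. \<Prod>i\<in>UNIV. f i (v $ i)) = (\<Prod>i\<in>UNIV. \<Sum>b\<in>A. f i b)"
proof -
  have "(\<Prod>i\<in>UNIV. \<Sum>b\<in>A. f i b) = (\<Sum>g\<in>PiE UNIV (\<lambda>_::'n. A). \<Prod>i\<in>UNIV. f i (g i))"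
    by (rule prod_sum_PiE) (use assms in auto)
  also have "\<dots> = (\<Sum>v\<in>{v :: 'b ^ 'n. \<forall>i. v $ i \<in> A}. \<Prod>i\<in>UNIV. f i (v $ i))"
    by (rule sum.reindex_bij_witness[where i = vec_nth and j = vec_lambda])
      (auto simp: PiE_def Pi_def)
  finally show ?thesis by simp
qed

lemma finite_vec_box:
  assumes "finite A"
  shows "finite {v :: 'b ^ 'n. \<forall>i. v $ i \<in> A}"
proof -
  have "{v :: 'b ^ 'n. \<forall>i. v $ i \<in> A} \<subseteq> vec_lambda ` PiE UNIV (\<lambda>_. A)"
  proof
    fix v :: "'b ^ 'n" assume "v \<in> {v. \<forall>i. v $ i \<in> A}"
    then show "v \<in> vec_lambda ` PiE UNIV (\<lambda>_. A)"
      by (intro image_eqI[where x = "vec_nth v"]) auto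
  qed
  then show ?thesis
    using assms by (meson finite_PiE finite finite_imageI finite_subset)
qed

lemma prod_indicator_vec_eq:
  fixes k l :: "'b ^ 'n"
  shows "(\<Prod>i\<in>UNIV. if k $ i = l $ i then 1 else 0 :: complex) = (if k = l then 1 else 0)"
  by (auto simp: vec_eq_iff)

lemma finite_grid1: "finite (grid1 m)"
  by (simp add: grid1_def)

lemma finite_freqs1: "finite (freqs1 m)"
  by (simp add: freqs1_def)

lemma finite_grid: "finite (grid m)"
  unfolding grid_def by (rule finite_vec_box[OF finite_grid1])

lemma finite_freqs: "finite (freqs m)"
  unfolding freqs_def by (rule finite_vec_box[OF finite_freqs1])

section \<open>The exponentials in one dimension\<close>

lemma fourier1_cis: "fourier1 k x = of_real ((2 * pi) powr (- 1 / 2)) * cis (of_int k * x)"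
  by (simp add: fourier1_def cis_conv_exp)

lemma fourier1_mult_cnj:
  "fourier1 k x * cnj (fourier1 l y) = of_real (1 / (2 * pi)) * cis (of_int k * x - of_int l * y)"
proof -
  define c :: real where "c = (2 * pi) powr (- 1 / 2)"
  have "c * c = (2 * pi) powr (- 1)"
    unfolding c_def powr_add[symmetric] by (rule arg_cong[where f = "(powr) (2 * pi)"]) simp
  also have "\<dots> = 1 / (2 * pi)"
    by (subst powr_minus_divide, subst powr_one) simp_all
  finally have c: "c * c = 1 / (2 * pi)" .
  have "fourier1 k x * cnj (fourier1 l y) =
      of_real (c * c) * (cis (of_int k * x) * cis (- (of_int l * y)))"
    unfolding fourier1_cis c_def[symmetric] by (simp add: cis_cnj del: cis_mult)
  then show ?thesis by (simp add: c cis_mult)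
qed

lemma cis_2pi_int: "cis (2 * pi * of_int j) = 1"
  by (simp add: complex_eq_iff)

text \<open>
  The terms are the powers of an \<open>m\<close>-th root of unity \<open>q\<close>. For \<open>q \<noteq> 1\<close> the geometric sum is
  \<open>(q ^ m - 1) / (q - 1) = 0\<close>.
\<close>

lemma sum_cis_roots:
  fixes d :: int
  assumes "m > 0"
  shows "(\<Sum>j<m. cis (2 * pi * of_int d / real m * real j)) = (if int m dvd d then of_nat m else 0)"
proof -
  define q where "q = cis (2 * pi * of_int d / real m)"
  have pow: "cis (2 * pi * of_int d / real m * real j) = q ^ j" for j
    unfolding q_def Complex.DeMoivre by (rule arg_cong[where f = cis]) simp
  have qm: "q ^ m = 1"
  proof -
    have "q ^ m = cis (2 * pi * of_int d)"
      unfolding q_def Complex.DeMoivre by (rule arg_cong[where f = cis]) (use assms in simp)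
    then show ?thesis by (simp only: cis_2pi_int)
  qed
  show ?thesis
  proof (cases "int m dvd d")
    case True
    then obtain e where "d = int m * e" by blast
    then have "2 * pi * of_int d / real m = 2 * pi * of_int e" using assms by simp
    then have "q = 1" by (simp only: q_def cis_2pi_int)
    then show ?thesis unfolding pow using True by simp
  next
    case False
    have "q \<noteq> 1"
    proof
      assume "q = 1"
      then obtain n :: int where "2 * pi * of_int d / real m = of_int (2 * n) * pi"
        by (auto simp: q_def cis_conv_exp exp_eq_1)
      then have "real_of_int d = of_int (n * int m)"
        using assms by (simp add: field_simps)
      then have "d = n * int m" by (simp only: of_int_eq_iff)
      then show False using False by simp
    qed
    then show ?thesis unfolding pow using False qm by (simp add: sum_gp_strict)
  qed
qed

text \<open>
  Used for differences \<open>d\<close> of two indices from a window of length \<open>m\<close>: within the window,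
  congruence modulo \<open>m\<close> is equality.
\<close>

lemma window_dvd_diff_iff:
  fixes d :: int
  assumes "\<bar>d\<bar> < int m"
  shows "int m dvd d \<longleftrightarrow> d = 0"
  using assms zdvd_not_zless[of "\<bar>d\<bar>" "int m"] by (cases "d = 0") auto

lemma freqs1_eq_image:
  assumes "even m"
  shows "freqs1 m = (\<lambda>j. int j - int (m div 2)) ` {..<m}"
proof
  show "freqs1 m \<subseteq> (\<lambda>j. int j - int (m div 2)) ` {..<m}"
  proof
    fix k assume "k \<in> freqs1 m"
    then show "k \<in> (\<lambda>j. int j - int (m div 2)) ` {..<m}"
      using assms by (intro image_eqI[where x = "nat (k + int (m div 2))"]) (auto simp: freqs1_def)
  qed
  show "(\<lambda>j. int j - int (m div 2)) ` {..<m} \<subseteq> freqs1 m"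
    using assms by (auto simp: freqs1_def)
qed

lemma inj_on_grid1_points:
  assumes "m > 0"
  shows "inj_on (\<lambda>j. - pi + 2 * pi / real m * real j) {..<m}"
  using assms by (auto simp: inj_on_def)

lemma grid1_orthogonality:
  assumes "even m" "m > 0" "k \<in> freqs1 m" "l \<in> freqs1 m"
  shows "of_real (2 * pi / real m) * (\<Sum>z\<in>grid1 m. fourier1 k z * cnj (fourier1 l z)) =
    (if k = l then 1 else 0)"
proof -
  \<comment> \<open>The phase factor accounts for the grid starting at \<open>- pi\<close>.\<close>
  have "(\<Sum>z\<in>grid1 m. cis (of_int k * z - of_int l * z)) =
      (\<Sum>j<m. cis (- of_int (k - l) * pi) * cis (2 * pi * of_int (k - l) / real m * real j))"
    unfolding grid1_def sum.reindex[OF inj_on_grid1_points[OF assms(2)]] o_def cis_mult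
    by (intro sum.cong refl arg_cong[where f = cis]) (use assms(2) in \<open>simp add: field_simps\<close>)
  also have "\<dots> = cis (- of_int (k - l) * pi) * (if int m dvd k - l then of_nat m else 0)"
    by (simp only: sum_distrib_left[symmetric] sum_cis_roots[OF assms(2)])
  also have "int m dvd k - l \<longleftrightarrow> k = l"
    by (subst window_dvd_diff_iff) (use assms in \<open>auto simp: freqs1_def\<close>)
  finally have sum: "(\<Sum>z\<in>grid1 m. cis (of_int k * z - of_int l * z)) =
      (if k = l then of_nat m else 0)"
    by simp
  show ?thesis
    unfolding fourier1_mult_cnj sum_distrib_left[symmetric] sum using assms(2) by simp
qed

text \<open>
  The matrix of the exponentials is square, so orthonormality of its columns passes to its rows; as
  the rows are again geometric progressions, the same root of unity sum proves it directly.
\<close>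

lemma grid1_dual_orthogonality:
  assumes "even m" "m > 0" "z \<in> grid1 m" "w \<in> grid1 m"
  shows "of_real (2 * pi / real m) * (\<Sum>k\<in>freqs1 m. fourier1 k z * cnj (fourier1 k w)) =
    (if z = w then 1 else 0)"
proof -
  obtain p where p: "p < m" "z = - pi + 2 * pi / real m * real p"
    using assms(3) by (auto simp: grid1_def)
  obtain r where r: "r < m" "w = - pi + 2 * pi / real m * real r"
    using assms(4) by (auto simp: grid1_def)
  define d where "d = int p - int r"
  have diff: "z - w = 2 * pi * of_int d / real m"
    using assms(2) by (simp add: p r d_def field_simps)
  \<comment> \<open>The phase factor accounts for the window of frequencies starting at \<open>-m/2\<close>.\<close>
  have "(\<Sum>k\<in>freqs1 m. cis (of_int k * z - of_int k * w)) =
      (\<Sum>j<m. cis (- real (m div 2) * (z - w)) * cis (2 * pi * of_int d / real m * real j))"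
    unfolding freqs1_eq_image[OF assms(1)] diff[symmetric] cis_mult
    by (subst sum.reindex) (auto simp: inj_on_def algebra_simps)
  also have "\<dots> = cis (- real (m div 2) * (z - w)) * (if int m dvd d then of_nat m else 0)"
    by (simp only: sum_distrib_left[symmetric] sum_cis_roots[OF assms(2)])
  also have "int m dvd d \<longleftrightarrow> z = w"
    by (subst window_dvd_diff_iff) (use p r diff assms(2) in \<open>auto simp: d_def\<close>)
  finally have sum: "(\<Sum>k\<in>freqs1 m. cis (of_int k * z - of_int k * w)) =
      (if z = w then of_nat m else 0)"
    by simp
  show ?thesis
    unfolding fourier1_mult_cnj sum_distrib_left[symmetric] sum using assms(2) by simp
qed

section \<open>The discrete Fourier transform in several dimensions\<close>

lemma fourier_eq_prod: "fourier k x = (\<Prod>i\<in>UNIV. fourier1 (k $ i) (x $ i))"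
proof -
  have "((2 * pi) powr (- 1 / 2)) ^ CARD('a) = (2 * pi) powr (- real CARD('a) / 2)"
    by (subst powr_realpow[symmetric]) (simp_all add: powr_powr)
  then show ?thesis
    by (simp add: fourier_def fourier1_def phase_def prod.distrib exp_sum sum_distrib_left
        flip: of_real_power)
qed

lemma grid_orthogonality:
  fixes k l :: "int ^ 'n"
  assumes "even m" "m > 0" "k \<in> freqs m" "l \<in> freqs m"
  shows "of_real ((2 * pi / real m) ^ CARD('n)) * (\<Sum>z\<in>grid m. fourier k z * cnj (fourier l z)) =
    (if k = l then 1 else 0)"
proof -
  have "(\<Sum>z\<in>grid m. fourier k z * cnj (fourier l z)) =
      (\<Prod>i\<in>UNIV. \<Sum>z\<in>grid1 m. fourier1 (k $ i) z * cnj (fourier1 (l $ i) z))"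
    unfolding grid_def fourier_eq_prod cnj_prod prod.distrib[symmetric]
    by (rule sum_vec_box_prod[OF finite_grid1])
  then have "of_real ((2 * pi / real m) ^ CARD('n)) * (\<Sum>z\<in>grid m. fourier k z * cnj (fourier l z)) =
      (\<Prod>i\<in>UNIV. of_real (2 * pi / real m) *
        (\<Sum>z\<in>grid1 m. fourier1 (k $ i) z * cnj (fourier1 (l $ i) z)))"
    by (simp only: prod.distrib prod_constant of_real_power)
  also have "\<dots> = (\<Prod>i\<in>UNIV. if k $ i = l $ i then 1 else 0)"
    by (intro prod.cong refl grid1_orthogonality) (use assms in \<open>auto simp: freqs_def\<close>)
  finally show ?thesis by (simp only: prod_indicator_vec_eq)
qed

lemma grid_dual_orthogonality:
  fixes z w :: "real ^ 'n"
  assumes "even m" "m > 0" "z \<in> grid m" "w \<in> grid m"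
  shows "of_real ((2 * pi / real m) ^ CARD('n)) * (\<Sum>k\<in>freqs m. fourier k z * cnj (fourier k w)) =
    (if z = w then 1 else 0)"
proof -
  have "(\<Sum>k\<in>freqs m. fourier k z * cnj (fourier k w)) =
      (\<Prod>i\<in>UNIV. \<Sum>k\<in>freqs1 m. fourier1 k (z $ i) * cnj (fourier1 k (w $ i)))"
    unfolding freqs_def fourier_eq_prod cnj_prod prod.distrib[symmetric]
    by (rule sum_vec_box_prod[OF finite_freqs1])
  then have "of_real ((2 * pi / real m) ^ CARD('n)) * (\<Sum>k\<in>freqs m. fourier k z * cnj (fourier k w)) =
      (\<Prod>i\<in>UNIV. of_real (2 * pi / real m) *
        (\<Sum>k\<in>freqs1 m. fourier1 k (z $ i) * cnj (fourier1 k (w $ i))))"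
    by (simp only: prod.distrib prod_constant of_real_power)
  also have "\<dots> = (\<Prod>i\<in>UNIV. if z $ i = w $ i then 1 else 0)"
    by (intro prod.cong refl grid1_dual_orthogonality) (use assms in \<open>auto simp: grid_def\<close>)
  finally show ?thesis by (simp only: prod_indicator_vec_eq)
qed

definition synthesis :: "nat \<Rightarrow> (int ^ 'n \<Rightarrow> complex) \<Rightarrow> real ^ 'n \<Rightarrow> complex" where
  "synthesis m c = (\<lambda>z\<in>grid m. \<Sum>k\<in>freqs m. c k * fourier k z)"

lemma synthesis_extensional: "synthesis m c \<in> extensional (grid m)"
  by (simp add: synthesis_def)

lemma qinner_synthesis_fourier_grid:
  fixes c :: "int ^ 'n \<Rightarrow> complex"
  assumes "even m" "m > 0" "l \<in> freqs m"
  shows "qinner m (synthesis m c) (fourier_grid m l) = c l"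
proof -
  let ?h = "complex_of_real ((2 * pi / real m) ^ CARD('n))"
  have "qinner m (synthesis m c) (fourier_grid m l) =
      ?h * (\<Sum>z\<in>grid m. \<Sum>k\<in>freqs m. c k * (fourier k z * cnj (fourier l z)))"
    by (simp add: qinner_def synthesis_def fourier_grid_def sum_distrib_right mult.assoc)
  also have "\<dots> = (\<Sum>k\<in>freqs m. c k * (?h * (\<Sum>z\<in>grid m. fourier k z * cnj (fourier l z))))"
    by (subst sum.swap) (simp only: sum_distrib_left mult.left_commute)
  also have "\<dots> = (\<Sum>k\<in>freqs m. c k * (if k = l then 1 else 0))"
    by (intro sum.cong refl arg_cong2[where f = "(*)"] grid_orthogonality assms)
  also have "\<dots> = c l"
    using assms(3) by (simp add: finite_freqs if_distrib cong: if_cong)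
  finally show ?thesis .
qed

lemma dft_synthesis:
  assumes "even m" "m > 0"
  shows "dft m (synthesis m c) = restrict c (freqs m)"
  unfolding dft_def
  by (rule restrict_ext) (rule qinner_synthesis_fourier_grid[OF assms])

lemma synthesis_dft:
  fixes v :: "real ^ 'n \<Rightarrow> complex"
  assumes "even m" "m > 0" "v \<in> extensional (grid m)"
  shows "synthesis m (dft m v) = v"
proof (rule extensionalityI[OF synthesis_extensional assms(3)])
  fix w :: "real ^ 'n" assume w: "w \<in> grid m"
  let ?h = "complex_of_real ((2 * pi / real m) ^ CARD('n))"
  have "synthesis m (dft m v) w =
      (\<Sum>k\<in>freqs m. \<Sum>z\<in>grid m. ?h * (v z * (fourier k w * cnj (fourier k z))))"
    using w by (simp add: synthesis_def dft_def qinner_def fourier_grid_def sum_distrib_left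
        sum_distrib_right mult_ac)
  also have "\<dots> = (\<Sum>z\<in>grid m. v z * (?h * (\<Sum>k\<in>freqs m. fourier k w * cnj (fourier k z))))"
    by (subst sum.swap) (simp only: sum_distrib_left mult.left_commute)
  also have "\<dots> = (\<Sum>z\<in>grid m. v z * (if w = z then 1 else 0))"
    by (intro sum.cong refl arg_cong2[where f = "(*)"] grid_dual_orthogonality assms w)
  also have "\<dots> = v w"
    using w by (simp add: finite_grid if_distrib cong: if_cong)
  finally show "synthesis m (dft m v) w = v w" .
qed

text \<open>
  Since \<open>inv_dft\<close> selects an arbitrary extensional preimage, having \<open>synthesis m c\<close> as one preimage
  is not enough: injectivity of the transform, that is completeness of the exponentials, identifies
  the selected one.
\<close>

lemma inv_dft_restrict:
  assumes "even m" "m > 0"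
  shows "inv_dft m (restrict c (freqs m)) = synthesis m c"
proof -
  have "inj_on (dft m) (extensional (grid m))"
    by (rule inj_on_inverseI[where g = "synthesis m"]) (rule synthesis_dft[OF assms])
  then show ?thesis
    unfolding inv_dft_def dft_synthesis[OF assms, symmetric]
    by (rule inv_into_f_f[OF _ synthesis_extensional])
qed

lemma discrete_op_synthesis:
  assumes "even m" "m > 0"
  shows "discrete_op m a x (synthesis m c) = synthesis m (\<lambda>k. a x k * c k)"
proof -
  have "(\<lambda>k\<in>freqs m. a x k * dft m (synthesis m c) k) = (\<lambda>k\<in>freqs m. a x k * c k)"
    by (rule restrict_ext) (simp add: dft_synthesis[OF assms])
  then show ?thesis
    by (simp add: discrete_op_def inv_dft_restrict[OF assms])
qed

text \<open>
  Parseval's identity. It suffices to expand the second argument, because the scalar products with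
  single exponentials are the coefficients of the first.
\<close>

lemma qinner_synthesis:
  fixes c d :: "int ^ 'n \<Rightarrow> complex"
  assumes "even m" "m > 0"
  shows "qinner m (synthesis m c) (synthesis m d) = (\<Sum>k\<in>freqs m. c k * cnj (d k))"
proof -
  have "qinner m (synthesis m c) (synthesis m d) =
      (\<Sum>k\<in>freqs m. qinner m (synthesis m c) (fourier_grid m k) * cnj (d k))"
    unfolding qinner_def fourier_grid_def
    by (simp add: synthesis_def[of m d] sum_distrib_left sum_distrib_right mult_ac)
      (rule sum.swap)
  then show ?thesis by (simp add: qinner_synthesis_fourier_grid[OF assms])
qed

section \<open>Discrete Dirac distributions\<close>

lemma delta_eq_sum:
  fixes x0 z :: "real ^ 'n"
  assumes "z \<in> grid m"
  shows "delta m x0 z = (\<Sum>k\<in>freqs m. fourier k x0 * cnj (fourier k z))"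
proof -
  have "delta m x0 z =
      (\<Prod>i\<in>UNIV. \<Sum>k\<in>freqs1 m. fourier1 k (x0 $ i) * cnj (fourier1 k (z $ i)))"
    using assms by (simp add: delta_def delta1_def grid_def)
  also have "\<dots> = (\<Sum>k\<in>freqs m. fourier k x0 * cnj (fourier k z))"
    unfolding freqs_def fourier_eq_prod cnj_prod prod.distrib[symmetric]
    by (rule sum_vec_box_prod[OF finite_freqs1, symmetric])
  finally show ?thesis .
qed

lemma grid_cnj_delta:
  "grid_cnj m (delta m x0) = synthesis m (\<lambda>k. cnj (fourier k x0))"
  unfolding grid_cnj_def synthesis_def
  by (rule restrict_ext) (simp add: delta_eq_sum)

text \<open>
  Negation modulo \<open>m\<close>, with representatives taken in \<open>freqs1 m\<close>: the frequency
  \<open>-m/2\<close> is its own negative.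
\<close>

definition neg_freq1 :: "nat \<Rightarrow> int \<Rightarrow> int" where
  "neg_freq1 m k = (if k = - (int m div 2) then k else - k)"

definition neg_freq :: "nat \<Rightarrow> int ^ 'n \<Rightarrow> int ^ 'n" where
  "neg_freq m k = (\<chi> i. neg_freq1 m (k $ i))"

lemma neg_freq1_involutive: "k \<in> freqs1 m \<Longrightarrow> neg_freq1 m (neg_freq1 m k) = k"
  by (auto simp: freqs1_def neg_freq1_def)

lemma neg_freq_involutive: "k \<in> freqs m \<Longrightarrow> neg_freq m (neg_freq m k) = k"
  by (simp add: freqs_def neg_freq_def vec_eq_iff neg_freq1_involutive)

lemma neg_freq1_in_freqs1: "k \<in> freqs1 m \<Longrightarrow> neg_freq1 m k \<in> freqs1 m"
  by (auto simp: freqs1_def neg_freq1_def)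

lemma neg_freq_in_freqs: "k \<in> freqs m \<Longrightarrow> neg_freq m k \<in> freqs m"
  by (simp add: freqs_def neg_freq_def neg_freq1_in_freqs1)

text \<open>
  Aliasing: two frequencies that agree modulo \<open>m\<close> are indistinguishable at points where the
  exponential of frequency \<open>m\<close> equals \<open>1\<close>. For even \<open>m\<close> these include the grid points as well
  as their differences, and both kinds of points are needed below.
\<close>

lemma fourier1_neg_freq1:
  assumes "even m" "cis (real m * t) = 1"
  shows "fourier1 (neg_freq1 m k) t = cnj (fourier1 k t)"
proof (cases "k = - (int m div 2)")
  case True
  have half: "real_of_int (int m div 2) = real m / 2"
    using assms(1) by (auto elim!: evenE)
  have "cis (real m / 2 * t) = cis (- (real m / 2 * t)) * cis (real m * t)"
    unfolding cis_mult by (rule arg_cong[where f = cis]) (simp add: field_simps)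
  then show ?thesis
    using True assms(2) by (simp add: neg_freq1_def fourier1_cis cis_cnj half)
next
  case False
  then show ?thesis by (simp add: neg_freq1_def fourier1_cis cis_cnj)
qed

lemma fourier_neg_freq:
  assumes "even m" "\<And>i. cis (real m * t $ i) = 1"
  shows "fourier (neg_freq m k) t = cnj (fourier k t)"
  unfolding fourier_eq_prod cnj_prod neg_freq_def
  by (simp add: fourier1_neg_freq1[OF assms])

lemma cis_grid1:
  assumes "even m" "m > 0" "t \<in> grid1 m"
  shows "cis (real m * t) = 1"
proof -
  obtain j where "t = - pi + 2 * pi / real m * real j"
    using assms(3) by (auto simp: grid1_def)
  moreover obtain n where "m = 2 * n"
    using assms(1) by blast
  ultimately have "real m * t = 2 * pi * of_int (int j - int n)"
    using assms(2) by (simp add: field_simps)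
  then show ?thesis by (simp only: cis_2pi_int)
qed

lemma delta_eq_synthesis:
  fixes x0 :: "real ^ 'n"
  assumes "even m" "m > 0"
  shows "delta m x0 = synthesis m (\<lambda>k. fourier (neg_freq m k) x0)"
proof (rule extensionalityI[OF _ synthesis_extensional])
  show "delta m x0 \<in> extensional (grid m)" by (simp add: delta_def)
  fix z :: "real ^ 'n" assume z: "z \<in> grid m"
  have "delta m x0 z = (\<Sum>k\<in>freqs m. fourier k x0 * fourier (neg_freq m k) z)"
    unfolding delta_eq_sum[OF z]
    using z by (subst fourier_neg_freq) (auto simp: assms grid_def intro!: cis_grid1)
  also have "\<dots> = (\<Sum>k\<in>freqs m. fourier (neg_freq m k) x0 * fourier k z)"
    by (rule sum.reindex_bij_witness[where i = "neg_freq m" and j = "neg_freq m"])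
      (auto simp: neg_freq_involutive neg_freq_in_freqs)
  finally show "delta m x0 z = synthesis m (\<lambda>k. fourier (neg_freq m k) x0) z"
    using z by (simp add: synthesis_def)
qed

section \<open>The truncated kernel\<close>

lemma fourier_mult_cnj:
  fixes x y :: "real ^ 'n"
  shows "fourier k x * cnj (fourier k y) =
    of_real (1 / (2 * pi) ^ CARD('n)) * exp (\<i> * of_real (phase k (x - y)))"
proof -
  have "fourier k x * cnj (fourier k y) =
      (\<Prod>i\<in>UNIV. of_real (1 / (2 * pi)) * cis (of_int (k $ i) * (x $ i - y $ i)))"
    unfolding fourier_eq_prod cnj_prod prod.distrib[symmetric] fourier1_mult_cnj
    by (simp add: right_diff_distrib)
  also have "\<dots> = of_real (1 / (2 * pi)) ^ CARD('n) *
      (\<Prod>i\<in>UNIV. cis (of_int (k $ i) * (x $ i - y $ i)))"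
    by (simp only: prod.distrib prod_constant)
  finally show ?thesis
    by (simp add: cis_conv_exp phase_def sum_distrib_left exp_sum power_divide)
qed

lemma truncated_kernel_eq_sum:
  "truncated_kernel m a x y = (\<Sum>k\<in>freqs m. a x k * (fourier k x * cnj (fourier k y)))"
  by (simp add: truncated_kernel_def kernel_term_def fourier_mult_cnj mult_ac)

text \<open>
  Both sides depend on \<open>x - y\<close> alone, so aliasing is applied at this difference rather than at the
  points themselves, which may lie off the grid.
\<close>

lemma fourier_neg_freq_mult_cnj:
  assumes "even m" "\<And>i. cis (real m * (x - y) $ i) = 1"
  shows "fourier (neg_freq m k) y * cnj (fourier (neg_freq m k) x) =
    fourier k x * cnj (fourier k y)"
proof -
  have translate: "fourier l x * cnj (fourier l y) = fourier l (x - y) * cnj (fourier l 0)" for l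
    by (simp add: fourier_mult_cnj)
  have zero: "fourier l 0 = fourier l' 0" "cnj (fourier l 0) = fourier l 0" for l l' :: "int ^ 'a"
    by (simp_all add: fourier_def phase_def)
  have "fourier (neg_freq m k) y * cnj (fourier (neg_freq m k) x) =
      cnj (fourier (neg_freq m k) x * cnj (fourier (neg_freq m k) y))"
    by simp
  also have "\<dots> = fourier k (x - y) * cnj (fourier k 0)"
    unfolding translate fourier_neg_freq[OF assms] using zero by simp
  finally show ?thesis by (simp only: translate)
qed

theorem theorem3p8:
  fixes a :: "real ^ 'n \<Rightarrow> int ^ 'n \<Rightarrow> complex" and m :: nat and x y :: "real ^ 'n"
  assumes "periodic_symbol a" and "even m" and "m > 0" and "x \<in> base_cube" and "y \<in> base_cube"
  shows "truncated_kernel m a x y =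
           qinner m (discrete_op m a x (grid_cnj m (delta m y))) (grid_cnj m (delta m x)) \<and>
         ((\<forall>i. \<exists>j::int. x $ i - y $ i = 2 * pi / real m * of_int j) \<longrightarrow>
           truncated_kernel m a x y = qinner m (discrete_op m a x (delta m y)) (delta m x))"
proof (intro conjI impI)
  note m = assms(2,3)
  show "truncated_kernel m a x y =
      qinner m (discrete_op m a x (grid_cnj m (delta m y))) (grid_cnj m (delta m x))"
    by (simp add: grid_cnj_delta discrete_op_synthesis[OF m] qinner_synthesis[OF m]
        truncated_kernel_eq_sum mult_ac)
  assume lattice: "\<forall>i. \<exists>j::int. x $ i - y $ i = 2 * pi / real m * of_int j"
  have cis1: "cis (real m * (x - y) $ i) = 1" for i
  proof -
    obtain j :: int where "x $ i - y $ i = 2 * pi / real m * of_int j"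
      using lattice by blast
    then have "real m * (x - y) $ i = 2 * pi * of_int j"
      using m(2) by simp
    then show ?thesis by (simp only: cis_2pi_int)
  qed
  show "truncated_kernel m a x y = qinner m (discrete_op m a x (delta m y)) (delta m x)"
    by (simp add: delta_eq_synthesis[OF m] discrete_op_synthesis[OF m] qinner_synthesis[OF m]
        truncated_kernel_eq_sum fourier_neg_freq_mult_cnj[OF m(1) cis1] mult.assoc)
qed

end
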